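(* Let $X$ be a sequentially complete Hausdorff locally convex space over $\mathbb{C}$. For every Dirichlet series $D=\sum_n a_n\frac{1}{n^s}$ with coefficients $a_n\in X$, one has $\sigma_u(D)=\sup_{x'\in X'}\sigma_u(x'(D))$.
   Context: $X'$ denotes the topological dual of $X$. For a Dirichlet series $D=\sum_n a_n\frac1{n^s}$ with coefficients in $X$ (variable $s\in\mathbb{C}$), the abscissa of uniform convergence is $\sigma_u(D):=\inf\{r\in\mathbb{R} : \sum_n a_n\frac1{n^s}\text{ converges uniformly in }X\text{ on }\{s\in\mathbb{C}:\operatorname{Re}s>r\}\}$, the infimum being taken in the extended real line (so it is $+\infty$ if there is no such $r$). For $x'\in X'$, $x'(D)$ denotes the scalar Dirichlet series $\sum_n x'(a_n)\frac1{n^s}$, and $\sigma_u(x'(D))$ is its abscissa of uniform convergence (same definition with $X=\mathbb{C}$). *)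

theory Defs
  imports "HOL-Analysis.Analysis"
begin

text \<open>
  Scalar multiplication by complex numbers is an explicit parameter, since the library has no type
  class of complex vector spaces. On an additive group the class
  \<^class>\<open>uniform_topological_group_add\<close> forces the uniformity to be the one induced by the
  topology (lemma \<open>uniformity_eq_nhds_0\<close> below), so \<^const>\<open>Cauchy\<close> and the uniform
  convergence defined here are the usual notions for topological vector spaces. The Hausdorff
  property is not part of the locale; it is expressed by the class \<^class>\<open>t2_space\<close>.
\<close>

lemma uniformity_eq_nhds_0:
  "(uniformity :: ('a \<times> 'a) filter) =
     filtercomap (\<lambda>(x, y). y - x :: 'a :: {ab_group_add, uniform_topological_group_add}) (nhds 0)"
  by (rule cauchy_seq_finset_iff_vanishing)

locale complex_lcs = vector_space smul
  for smul :: "complex \<Rightarrow> 'a \<Rightarrow> 'a :: {ab_group_add, uniform_topological_group_add}" +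
  assumes continuous_scale: "continuous_on UNIV (\<lambda>(c, x). smul c x)"
    and locally_convex:
      "eventually (\<lambda>x. x \<in> U) (nhds 0) \<Longrightarrow>
         \<exists>V\<subseteq>U. eventually (\<lambda>x. x \<in> V) (nhds 0) \<and>
           (\<forall>x\<in>V. \<forall>y\<in>V. \<forall>u\<ge>0. \<forall>v\<ge>0. u + v = 1 \<longrightarrow>
              smul (of_real u) x + smul (of_real v) y \<in> V)"

definition topological_dual ::
  "(complex \<Rightarrow> 'a \<Rightarrow> 'a) \<Rightarrow> ('a :: {ab_group_add, topological_space} \<Rightarrow> complex) set"
  where "topological_dual smul = {f. Vector_Spaces.linear smul (*) f \<and> continuous_on UNIV f}"

text \<open>
  \<^const>\<open>uniformly_convergent_on\<close> is restricted to metric spaces; this is its counterpart for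
  uniform spaces.
\<close>

definition unif_convergent_on :: "'s set \<Rightarrow> (nat \<Rightarrow> 's \<Rightarrow> 'a :: uniform_space) \<Rightarrow> bool"
  where "unif_convergent_on S F \<longleftrightarrow>
    (\<exists>l. \<forall>E. eventually E uniformity \<longrightarrow> (\<forall>\<^sub>F N in sequentially. \<forall>s\<in>S. E (F N s, l s)))"

lemma unif_convergent_on_metric:
  fixes F :: "nat \<Rightarrow> 's \<Rightarrow> 'a :: metric_space"
  shows "unif_convergent_on S F \<longleftrightarrow> uniformly_convergent_on S F"
proof -
  have "(\<forall>E. eventually E uniformity \<longrightarrow> (\<forall>\<^sub>F N in sequentially. \<forall>s\<in>S. E (F N s, l s))) \<longleftrightarrow>
        uniform_limit S F l sequentially" (is "?L \<longleftrightarrow> ?R") for l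
  proof
    assume L: ?L
    show ?R
    proof (rule uniform_limitI)
      fix e :: real assume "e > 0"
      then have "eventually (\<lambda>(x :: 'a, y). dist x y < e) uniformity"
        unfolding eventually_uniformity_metric by blast
      with L show "\<forall>\<^sub>F N in sequentially. \<forall>s\<in>S. dist (F N s) (l s) < e"
        by fastforce
    qed
  next
    assume R: ?R
    show ?L
    proof (intro allI impI)
      fix E :: "'a \<times> 'a \<Rightarrow> bool" assume "eventually E uniformity"
      then obtain e where "e > 0" and e: "\<And>x y. dist x y < e \<Longrightarrow> E (x, y)"
        unfolding eventually_uniformity_metric by blast
      from uniform_limitD[OF R \<open>e > 0\<close>]
      show "\<forall>\<^sub>F N in sequentially. \<forall>s\<in>S. E (F N s, l s)"
        by (rule eventually_mono) (use e in blast)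
    qed
  qed
  then show ?thesis
    unfolding unif_convergent_on_def uniformly_convergent_on_def by simp
qed

text \<open>
  A Dirichlet series is given by its coefficient sequence; series are indexed from 1, and the value
  at 0 of the coefficient sequence is ignored.
\<close>

definition dirichlet_partial_sum ::
  "(complex \<Rightarrow> 'a \<Rightarrow> 'a) \<Rightarrow> (nat \<Rightarrow> 'a) \<Rightarrow> nat \<Rightarrow> complex \<Rightarrow> 'a :: ab_group_add"
  where "dirichlet_partial_sum smul a N s = (\<Sum>n = 1..N. smul (1 / of_nat n powr s) (a n))"

definition sigma_u ::
  "(complex \<Rightarrow> 'a \<Rightarrow> 'a) \<Rightarrow> (nat \<Rightarrow> 'a :: {ab_group_add, uniform_space}) \<Rightarrow> ereal"
  where "sigma_u smul a =
    (INF r \<in> {r :: real. unif_convergent_on {s. Re s > r} (dirichlet_partial_sum smul a)}. ereal r)"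

end

theory Submission
  imports Defs
begin

text \<open>
  If every \<open>x'(D)\<close> converges uniformly on \<open>Re s > r\<close>, the set of all partial sums of \<open>D\<close> at such
  points is weakly bounded, hence bounded by Mackey's theorem, and summation by parts makes \<open>D\<close>
  uniformly Cauchy on \<open>Re s > r + d\<close> for every \<open>d > 0\<close>. Conversely, a continuous functional maps
  uniformly convergent series to uniformly convergent series.
\<close>

text \<open>Each \<open>x'(D)\<close> converges uniformly at a speed that depends on
  \<open>x'\<close>, so the Cauchy property cannot be lifted to the whole space directly.
  Boundedness can be lifted, and the factor \<open>n powr (- d)\<close> turns it back into
  convergence; the price \<open>d\<close> disappears in the infimum that defines the abscissa. The
  lifting is done for one gauge \<open>p\<close> at a time: the signed series of the gliding hump is
  again a functional dominated by \<open>p\<close>, so the completeness behind this uniform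
  boundedness principle sits on the dual side, while sequential completeness of the space supplies
  the limits of the partial sums.\<close>

section \<open>Hahn-Banach for sublinear functionals on a real vector space\<close>

locale real_scaling = vector_space sc
  for sc :: "real \<Rightarrow> 'a \<Rightarrow> 'a :: ab_group_add"
begin

text \<open>Homogeneity is asked only as an inequality for \<open>t > 0\<close>, which is what
  infima yield most easily; applying it to \<open>1 / t\<close> as well gives equality. The case
  \<open>t = 0\<close> is the separate clause \<open>p 0 = 0\<close>.\<close>

definition sublinear :: "('a \<Rightarrow> real) \<Rightarrow> bool"
  where "sublinear p \<longleftrightarrow> p 0 = 0 \<and> (\<forall>x y. p (x + y) \<le> p x + p y) \<and>
    (\<forall>t>0. \<forall>x. p (sc t x) \<le> t * p x)"

lemma sublinear_zero: "sublinear p \<Longrightarrow> p 0 = 0"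
  and sublinear_add: "sublinear p \<Longrightarrow> p (x + y) \<le> p x + p y"
  unfolding sublinear_def by auto

lemma sublinear_scale:
  assumes "sublinear p" "t \<ge> 0"
  shows "p (sc t x) = t * p x"
proof (cases "t = 0")
  case True
  then show ?thesis using sublinear_zero[OF assms(1)] by simp
next
  case False
  with assms have "t > 0" by simp
  have "p x = p (sc (1 / t) (sc t x))" using \<open>t > 0\<close> by simp
  also have "\<dots> \<le> (1 / t) * p (sc t x)"
    using assms(1) \<open>t > 0\<close> unfolding sublinear_def by (metis divide_pos_pos zero_less_one)
  finally have "t * p x \<le> p (sc t x)" using \<open>t > 0\<close> by (simp add: field_simps)
  moreover have "p (sc t x) \<le> t * p x" using assms(1) \<open>t > 0\<close> unfolding sublinear_def by blast
  ultimately show ?thesis by simp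
qed

lemma sublinear_minus_ge: "sublinear p \<Longrightarrow> - p (- x) \<le> p x"
  using sublinear_add[of p x "- x"] sublinear_zero[of p] by simp

text \<open>Lowers \<open>p\<close> as far as possible along the ray spanned by \<open>y\<close>.
  The instance \<open>t = 1\<close> serves twice: it makes a minimal sublinear functional additive,
  and with \<open>x = - y\<close> it gives \<open>q (- y) \<le> - p y\<close>, which forces a
  functional below \<open>q\<close> to attain \<open>p\<close> at \<open>y\<close>.\<close>

lemma sublinear_lower:
  assumes p: "sublinear p"
  obtains q where "sublinear q" "\<And>x. q x \<le> p x" "\<And>x t. t \<ge> 0 \<Longrightarrow> q x \<le> p (x + sc t y) - t * p y"
proof -
  define q where "q x = (INF t\<in>{0..}. p (x + sc t y) - t * p y)" for x
  \<comment> \<open>Subadditivity for \<open>(x + sc t y) + (- x)\<close> keeps the infimum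
    finite.\<close>
  have lower: "- p (- x) \<le> p (x + sc t y) - t * p y" if "t \<ge> 0" for x t
    using sublinear_add[OF p, of "x + sc t y" "- x"] sublinear_scale[OF p that, of y] by simp
  have bdd: "bdd_below ((\<lambda>t. p (x + sc t y) - t * p y) ` {0..})" for x
    using lower by (intro bdd_belowI2[where m = "- p (- x)"]) auto
  have le: "q x \<le> p (x + sc t y) - t * p y" if "t \<ge> 0" for x t
    unfolding q_def using bdd that by (intro cINF_lower) auto
  have ge: "c \<le> q x" if "\<And>t. t \<ge> 0 \<Longrightarrow> c \<le> p (x + sc t y) - t * p y" for c x
    unfolding q_def using that by (intro cINF_greatest) auto
  have qp: "q x \<le> p x" for x
    using le[of 0 x] by simp
  have "sublinear q"
    unfolding sublinear_def
  proof (intro conjI allI impI)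
    have "0 \<le> q 0" using ge[of "- p (- 0)" 0] lower[of _ 0] sublinear_zero[OF p] by simp
    then show "q 0 = 0" using qp[of 0] sublinear_zero[OF p] by simp
  next
    fix u v
    \<comment> \<open>The parameter \<open>s + t\<close> is admissible for \<open>u + v\<close>; the
      infima over \<open>s\<close> and \<open>t\<close> are then taken one after the other.\<close>
    have "q (u + v) \<le> (p (u + sc s y) - s * p y) + (p (v + sc t y) - t * p y)"
      if "s \<ge> 0" "t \<ge> 0" for s t
    proof -
      have "q (u + v) \<le> p (u + v + sc (s + t) y) - (s + t) * p y"
        using that by (intro le) simp
      also have "u + v + sc (s + t) y = (u + sc s y) + (v + sc t y)"
        by (simp add: scale_left_distrib algebra_simps)
      finally show ?thesis
        using sublinear_add[OF p, of "u + sc s y" "v + sc t y"] by (simp add: algebra_simps)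
    qed
    note split = this
    have "q (u + v) - (p (u + sc s y) - s * p y) \<le> q v" if "s \<ge> 0" for s
    proof (rule ge)
      fix t :: real assume "t \<ge> 0"
      from split[OF \<open>s \<ge> 0\<close> this]
      show "q (u + v) - (p (u + sc s y) - s * p y) \<le> p (v + sc t y) - t * p y" by simp
    qed
    then have "q (u + v) - q v \<le> q u"
      by (intro ge) (simp add: algebra_simps)
    then show "q (u + v) \<le> q u + q v" by simp
  next
    fix c :: real and u assume c: "c > 0"
    have "q (sc c u) / c \<le> p (u + sc t y) - t * p y" if "t \<ge> 0" for t
    proof -
      have "q (sc c u) \<le> p (sc c u + sc (c * t) y) - c * t * p y"
        using c that by (intro le) simp
      also have "sc c u + sc (c * t) y = sc c (u + sc t y)"
        by (simp add: scale_right_distrib)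
      also have "p \<dots> = c * p (u + sc t y)"
        using c by (intro sublinear_scale[OF p]) simp
      finally show ?thesis using c by (simp add: field_simps)
    qed
    then have "q (sc c u) / c \<le> q u" by (rule ge)
    then show "q (sc c u) \<le> c * q u" using c by (simp add: field_simps)
  qed
  with that qp le show thesis by blast
qed

text \<open>Zorn's lemma for the reversed pointwise order: a chain is bounded by its pointwise
  infimum, which is finite because every member is at least \<open>- p (- x)\<close> at
  \<open>x\<close>.\<close>

lemma minimal_sublinear:
  assumes p: "sublinear p"
  obtains m where "sublinear m" "m \<le> p" "\<And>q. sublinear q \<Longrightarrow> q \<le> m \<Longrightarrow> q = m"
proof -
  define A where "A = {q. sublinear q \<and> q \<le> p}"
  have "\<exists>m\<in>A. \<forall>q\<in>A. q \<le> m \<longrightarrow> q = m"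
  proof (rule predicate_Zorn)
    show "partial_order_on A (relation_of (\<lambda>q q'. q' \<le> q) A)"
      by (rule partial_order_on_relation_ofI) auto
  next
    fix C assume C: "C \<in> Chains (relation_of (\<lambda>q q'. q' \<le> q) A)"
    then have CA: "C \<subseteq> A" and chain: "\<And>q r. q \<in> C \<Longrightarrow> r \<in> C \<Longrightarrow> q \<le> r \<or> r \<le> q"
      unfolding Chains_def relation_of_def by blast+
    show "\<exists>u\<in>A. \<forall>q\<in>C. u \<le> q"
    proof (cases "C = {}")
      case True
      then show ?thesis using p unfolding A_def by auto
    next
      case False
      define u where "u x = (INF q\<in>C. q x)" for x
      have sub: "sublinear q" "q x \<le> p x" if "q \<in> C" for q x
        using CA that unfolding A_def le_fun_def by auto
      have bdd: "bdd_below ((\<lambda>q. q x) ` C)" for x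
      proof (rule bdd_belowI2)
        fix q assume "q \<in> C"
        then show "- p (- x) \<le> q x" using sublinear_minus_ge[OF sub(1), of q x] sub(2)[of q "- x"] by simp
      qed
      have le: "u x \<le> q x" if "q \<in> C" for q x
        unfolding u_def using bdd that by (intro cINF_lower) auto
      have ge: "c \<le> u x" if "\<And>q. q \<in> C \<Longrightarrow> c \<le> q x" for c x
        unfolding u_def using that False by (intro cINF_greatest) auto
      have "sublinear u"
        unfolding sublinear_def
      proof (intro conjI allI impI)
        have "q 0 = 0" if "q \<in> C" for q using sub(1)[OF that] by (rule sublinear_zero)
        then show "u 0 = 0" using False le[of _ 0] ge[of 0 0] by force
      next
        fix x y
        \<comment> \<open>Infima of sublinear functionals need not be subadditive; in a chain, the
          smaller of \<open>q\<close> and \<open>r\<close> serves both summands.\<close>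
        have "u (x + y) \<le> q x + r y" if "q \<in> C" "r \<in> C" for q r
        proof -
          from chain[OF that] that obtain w where w: "w \<in> C" "w \<le> q" "w \<le> r" by blast
          have "u (x + y) \<le> w (x + y)" by (rule le[OF w(1)])
          also have "\<dots> \<le> w x + w y" by (rule sublinear_add[OF sub(1)[OF w(1)]])
          also have "\<dots> \<le> q x + r y" using w(2,3) by (auto simp: le_fun_def intro: add_mono)
          finally show ?thesis .
        qed
        note split = this
        have "u (x + y) - q x \<le> u y" if "q \<in> C" for q
        proof (rule ge)
          fix r assume "r \<in> C"
          from split[OF \<open>q \<in> C\<close> this] show "u (x + y) - q x \<le> r y" by simp
        qed
        then have "u (x + y) - u y \<le> u x"
          by (intro ge) (simp add: algebra_simps)
        then show "u (x + y) \<le> u x + u y" by simp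
      next
        fix t :: real and x assume t: "t > 0"
        have "u (sc t x) / t \<le> q x" if "q \<in> C" for q
          using le[OF that, of "sc t x"] sublinear_scale[OF sub(1)[OF that], of t x] t
          by (simp add: field_simps)
        then have "u (sc t x) / t \<le> u x" by (rule ge)
        then show "u (sc t x) \<le> t * u x" using t by (simp add: field_simps)
      qed
      moreover have "u \<le> p"
      proof -
        from False obtain q where "q \<in> C" by blast
        then show ?thesis using order_trans[OF le[of q] sub(2)[of q]] by (simp add: le_fun_def)
      qed
      ultimately show ?thesis using le unfolding A_def le_fun_def by blast
    qed
  qed
  then obtain m where "m \<in> A" and "\<And>q. q \<in> A \<Longrightarrow> q \<le> m \<Longrightarrow> q = m" by blast
  with that[of m] show thesis unfolding A_def by (auto intro: order_trans)
qed

text \<open>Lowering \<open>m\<close> along \<open>y\<close> cannot change it, so the inequality for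
  \<open>t = 1\<close> becomes superadditivity.\<close>

lemma minimal_sublinear_linear:
  assumes m: "sublinear m" and min: "\<And>q. sublinear q \<Longrightarrow> q \<le> m \<Longrightarrow> q = m"
  shows "Vector_Spaces.linear sc (*) m"
proof -
  have add: "m (x + y) = m x + m y" for x y
  proof -
    from sublinear_lower[OF m, of y] obtain q where
      q: "sublinear q" "\<And>x. q x \<le> m x" "\<And>x t. t \<ge> 0 \<Longrightarrow> q x \<le> m (x + sc t y) - t * m y" by blast
    have "q = m" using min[OF q(1)] q(2) by (auto simp: le_fun_def)
    then have "m x \<le> m (x + y) - m y" using q(3)[of 1 x] by simp
    then show ?thesis using sublinear_add[OF m, of x y] by simp
  qed
  have minus: "m (- x) = - m x" for x
    using add[of x "- x"] sublinear_zero[OF m] by simp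
  have "m (sc t x) = t * m x" for t x
  proof (cases "t \<ge> 0")
    case True
    then show ?thesis by (rule sublinear_scale[OF m])
  next
    case False
    then have "m (sc (- t) x) = - t * m x" by (intro sublinear_scale[OF m]) simp
    then show ?thesis using minus[of "sc t x"] by simp
  qed
  with add show ?thesis
    unfolding Vector_Spaces.linear_iff
    by (auto simp: vector_space_axioms vector_space_def algebra_simps)
qed

theorem Hahn_Banach_sublinear:
  assumes p: "sublinear p"
  obtains f where "Vector_Spaces.linear sc (*) f" "\<And>x. f x \<le> p x" "f x0 = p x0"
proof -
  from sublinear_lower[OF p, of x0] obtain q where
    q: "sublinear q" "\<And>x. q x \<le> p x" "\<And>x t. t \<ge> 0 \<Longrightarrow> q x \<le> p (x + sc t x0) - t * p x0" by blast
  obtain f where f: "sublinear f" "f \<le> q" "\<And>r. sublinear r \<Longrightarrow> r \<le> f \<Longrightarrow> r = f"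
    using minimal_sublinear[OF q(1)] by blast
  have lin: "Vector_Spaces.linear sc (*) f" by (rule minimal_sublinear_linear[OF f(1,3)])
  then interpret f: Vector_Spaces.linear sc "(*)" f .
  have fp: "f x \<le> p x" for x using f(2) q(2)[of x] by (auto simp: le_fun_def intro: order_trans)
  \<comment> \<open>The lowered \<open>q\<close> at \<open>- x0\<close> with \<open>t = 1\<close> is
    at most \<open>p 0 - p x0\<close>.\<close>
  have "f (- x0) \<le> - p x0"
    using f(2) q(3)[of 1 "- x0"] sublinear_zero[OF p] by (auto simp: le_fun_def intro: order_trans)
  then have "p x0 \<le> f x0" by (simp add: f.neg)
  with fp[of x0] have "f x0 = p x0" by simp
  with lin fp that show thesis by blast
qed

section \<open>Uniform boundedness of a set tested by the functionals below a seminorm\<close>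

text \<open>
  Sokal's gliding hump: the functional is a signed series of norming functionals, the signs being
  chosen so that the \<open>k\<close>-th term does not cancel against the previous ones at the \<open>k\<close>-th point.
\<close>

theorem uniform_boundedness_sublinear:
  assumes p: "sublinear p" and sym: "\<And>x. p (- x) = p x"
    and bounded: "\<And>f. Vector_Spaces.linear sc (*) f \<Longrightarrow> (\<And>x. \<bar>f x\<bar> \<le> p x) \<Longrightarrow>
      \<exists>K. \<forall>x\<in>B. \<bar>f x\<bar> \<le> K"
  obtains K where "\<And>x. x \<in> B \<Longrightarrow> p x \<le> K"
proof -
  have "\<exists>K. \<forall>x\<in>B. p x \<le> K"
  proof (rule ccontr)
    assume "\<not> ?thesis"
    \<comment> \<open>Growth at rate 6 against weights decaying at rate 3 leaves
      \<open>2 ^ k\<close> at the end.\<close>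
    then have "\<forall>k::nat. \<exists>x\<in>B. p x > 6 ^ Suc k" by (meson not_le)
    then obtain X where X: "\<And>k. X k \<in> B" "\<And>k::nat. p (X k) > 6 ^ Suc k" by metis
    have "\<exists>g. Vector_Spaces.linear sc (*) g \<and> (\<forall>x. g x \<le> p x) \<and> g (X k) = p (X k)" for k
      using Hahn_Banach_sublinear[OF p, of "X k"] by metis
    then obtain g where g: "\<And>k. Vector_Spaces.linear sc (*) (g k)" "\<And>k x. g k x \<le> p x"
        "\<And>k. g k (X k) = p (X k)" by metis
    have g_add: "g k (x + y) = g k x + g k y" and g_scale: "g k (sc t x) = t * g k x"
      for k x y t
      using g(1)[of k] unfolding Vector_Spaces.linear_iff by auto
    have g_abs: "\<bar>g k x\<bar> \<le> p x" for k x
    proof -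
      have "- g k x = g k (- x)" using g_scale[of k "-1" x] by simp
      then show ?thesis using g(2)[of k x] g(2)[of k "- x"] sym[of x] by simp
    qed
    have p_nonneg: "p x \<ge> 0" for x using g_abs[of 0 x] by simp
    \<comment> \<open>With ratio 1/3 all terms after the \<open>k\<close>-th weigh
      \<open>c k / 2\<close> together, so half of the \<open>k\<close>-th hump survives; all weights
      sum to 1/2, which keeps \<open>f\<close> below \<open>p\<close>.\<close>
    define c :: "nat \<Rightarrow> real" where "c k = (1 / 3) ^ Suc k" for k
    have c_pos: "c k > 0" for k by (simp add: c_def)
    \<comment> \<open>The recursion is needed because the sign of the \<open>k\<close>-th term
      depends on the value at \<open>X k\<close> of the sum built so far.\<close>
    define F where "F = rec_nat (\<lambda>_. 0)
      (\<lambda>k h x. h x + (if h (X k) \<ge> 0 then 1 else -1) * c k * g k x)"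
    define e :: "nat \<Rightarrow> real" where "e k = (if F k (X k) \<ge> 0 then 1 else -1)" for k
    have F_0: "F 0 x = 0" and F_Suc: "F (Suc k) x = F k x + e k * c k * g k x" for k x
      by (simp_all add: F_def e_def)
    have F_sum: "F k x = (\<Sum>j<k. e j * c j * g j x)" for k x
      by (induction k) (simp_all add: F_0 F_Suc)
    have hump: "\<bar>F (Suc k) (X k)\<bar> \<ge> c k * p (X k)" for k
      using mult_nonneg_nonneg[OF less_imp_le[OF c_pos[of k]] p_nonneg[of "X k"]]
      by (auto simp: F_Suc e_def g(3))
    have term_bound: "norm (e k * c k * g k x) \<le> c k * p x" for k x
      using g_abs[of k x] c_pos[of k] by (simp add: e_def abs_mult)
    have tail: "(\<lambda>k. c (k + n) * p x) sums ((1/3) ^ n / 2 * p x)" for n x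
    proof -
      have "(\<lambda>k. (1/3::real) ^ k) sums (1 / (1 - 1/3))" by (rule geometric_sums) simp
      from sums_mult[OF this, of "(1/3) ^ Suc n * p x"] show ?thesis
        by (simp add: c_def power_add mult_ac)
    qed
    have summable: "summable (\<lambda>k. e k * c k * g k x)" for x
    proof (rule summable_comparison_test')
      show "summable (\<lambda>k. c k * p x)" using sums_summable[OF tail[where n = 0 and x = x]] by simp
      show "norm (e k * c k * g k x) \<le> c k * p x" if "k \<ge> 0" for k by (rule term_bound)
    qed
    define f where "f x = (\<Sum>k. e k * c k * g k x)" for x
    have f_diff: "\<bar>f x - F n x\<bar> \<le> (1/3) ^ n / 2 * p x" for n x
    proof -
      have "f x - F n x = (\<Sum>k. e (k + n) * c (k + n) * g (k + n) x)"
        unfolding f_def F_sum using suminf_minus_initial_segment[OF summable] by simp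
      also have "norm \<dots> \<le> (\<Sum>k. c (k + n) * p x)"
        by (rule norm_suminf_le[OF term_bound sums_summable[OF tail]])
      also have "\<dots> = (1/3) ^ n / 2 * p x" by (rule sums_unique[OF tail, symmetric])
      finally show ?thesis by simp
    qed
    have "Vector_Spaces.linear sc (*) f"
      unfolding Vector_Spaces.linear_iff
    proof (intro conjI allI)
      show "vector_space sc" by (rule vector_space_axioms)
      show "vector_space ((*) :: real \<Rightarrow> real \<Rightarrow> real)"
        by (simp add: vector_space_def algebra_simps)
      show "f (x + y) = f x + f y" for x y
        unfolding f_def using suminf_add[OF summable[of x] summable[of y]]
        by (simp add: g_add algebra_simps)
      show "f (sc t x) = t * f x" for t x
        unfolding f_def using suminf_mult[OF summable[of x], of t]
        by (simp add: g_scale mult_ac)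
    qed
    moreover have "\<bar>f x\<bar> \<le> p x" for x
      using f_diff[of x 0] p_nonneg[of x] by (simp add: F_0)
    ultimately obtain K where K: "\<And>x. x \<in> B \<Longrightarrow> \<bar>f x\<bar> \<le> K" using bounded by blast
    have "2 ^ k \<le> K" for k
    proof -
      have "(2::real) ^ k = (1/3) ^ Suc k / 2 * 6 ^ Suc k"
        using power_mult_distrib[of "2::real" 3 k] by (simp add: power_divide)
      also have "\<dots> \<le> (1/3) ^ Suc k / 2 * p (X k)"
        using X(2)[of k] by (intro mult_left_mono) auto
      also have "\<dots> \<le> \<bar>f (X k)\<bar>"
      proof -
        have "\<bar>f (X k) - F (Suc k) (X k)\<bar> \<le> c k * p (X k) / 2"
          using f_diff[of "X k" "Suc k"] by (simp add: c_def)
        with hump[of k] have "c k * p (X k) / 2 \<le> \<bar>f (X k)\<bar>" by linarith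
        then show ?thesis by (simp add: c_def)
      qed
      also have "\<dots> \<le> K" by (rule K[OF X(1)])
      finally show ?thesis .
    qed
    then show False using real_arch_pow[of 2 K] by (auto simp: not_less[symmetric])
  qed
  with that show thesis by blast
qed

end


section \<open>Gauges and weak boundedness in a complex locally convex space\<close>

lemma continuous_on_UNIV_iff_nhds: "continuous_on UNIV f \<longleftrightarrow> (\<forall>x. (f \<longlongrightarrow> f x) (nhds x))"
  by (simp add: continuous_on_def tendsto_at_iff_tendsto_nhds)

lemma additive_continuous_on_UNIV:
  fixes f :: "'a :: topological_group_add \<Rightarrow> 'b :: topological_group_add"
  assumes add: "\<And>x y. f (x + y) = f x + f y" and zero: "(f \<longlongrightarrow> 0) (nhds 0)"
  shows "continuous_on UNIV f"
  unfolding continuous_on_UNIV_iff_nhds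
proof
  fix x
  have "((\<lambda>y. f x + f (- x + y)) \<longlongrightarrow> f x + 0) (nhds x)"
  proof (intro tendsto_add tendsto_const filterlim_compose[OF zero])
    show "filterlim (\<lambda>y. - x + y) (nhds 0) (nhds x)"
      using tendsto_add[OF tendsto_const[of "- x"] filterlim_ident[of "nhds x"]] by simp
  qed
  then show "(f \<longlongrightarrow> f x) (nhds x)" by (simp flip: add add: add.assoc[symmetric])
qed

sublocale complex_lcs \<subseteq> real: real_scaling "\<lambda>t. smul (of_real t)"
  by unfold_locales (simp_all add: scale_right_distrib scale_left_distrib)

context complex_lcs
begin

lemma continuous_on_smul: "continuous_on UNIV (smul c)"
  using continuous_on_compose2[OF continuous_scale, of UNIV "\<lambda>x. (c, x)"]
  by (simp add: continuous_on_Pair continuous_on_const continuous_on_id)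

lemma continuous_on_smul_left: "continuous_on UNIV (\<lambda>c. smul c x)"
  using continuous_on_compose2[OF continuous_scale, of UNIV "\<lambda>c. (c, x)"]
  by (simp add: continuous_on_Pair continuous_on_const continuous_on_id)

lemma tendsto_smul: "(smul c \<longlongrightarrow> smul c x) (nhds x)"
  using continuous_on_smul unfolding continuous_on_UNIV_iff_nhds by blast

lemma tendsto_smul_left: "((\<lambda>c. smul c x) \<longlongrightarrow> smul c x) (nhds c)"
  using continuous_on_smul_left unfolding continuous_on_UNIV_iff_nhds by blast

text \<open>\<open>p\<close> is the Minkowski functional of a symmetric convex neighbourhood inside
  \<open>U\<close>. Symmetry under sign makes it a seminorm over the reals; it need not be invariant
  under complex scalars of modulus 1, and the real functionals below suffice.\<close>

lemma gauge_exists: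
  assumes "eventually (\<lambda>x. x \<in> U) (nhds 0)"
  obtains p where "real.sublinear p" "\<And>x. p (- x) = p x"
    "\<And>e. e > 0 \<Longrightarrow> \<forall>\<^sub>F x in nhds 0. p x < e" "\<And>x. p x < 1 \<Longrightarrow> x \<in> U"
proof -
  from locally_convex[OF assms] obtain V where "V \<subseteq> U" and V: "\<forall>\<^sub>F x in nhds 0. x \<in> V"
    and convex: "\<And>x y u v. \<lbrakk>x \<in> V; y \<in> V; u \<ge> 0; v \<ge> 0; u + v = 1\<rbrakk> \<Longrightarrow>
      smul (of_real u) x + smul (of_real v) y \<in> V"
    by blast
  define W where "W = {x. x \<in> V \<and> - x \<in> V}"
  have "filterlim uminus (nhds 0) (nhds (0 :: 'a))"
    using tendsto_minus[OF filterlim_ident[of "nhds (0 :: 'a)"]] by simp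
  then have "\<forall>\<^sub>F x in nhds 0. - x \<in> V" using V by (rule filterlim_iff[THEN iffD1, rule_format])
  with V have W: "\<forall>\<^sub>F x in nhds 0. x \<in> W" unfolding W_def by eventually_elim simp
  have "0 \<in> W" using eventually_nhds_x_imp_x[OF W] .
  have W_minus: "- x \<in> W" if "x \<in> W" for x using that by (simp add: W_def)
  have W_convex: "smul (of_real u) x + smul (of_real v) y \<in> W"
    if "x \<in> W" "y \<in> W" "u \<ge> 0" "v \<ge> 0" "u + v = 1" for x y and u v :: real
    using convex[of x y u v] convex[of "- x" "- y" u v] that by (simp add: W_def)
  \<comment> \<open>\<open>T x\<close> collects the \<open>t > 0\<close> with \<open>x\<close> in
    the dilate of \<open>W\<close> by \<open>t\<close>; it is nonempty because \<open>x / n\<close>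
    tends to 0.\<close>
  define T where "T x = {t::real. t > 0 \<and> smul (of_real (1 / t)) x \<in> W}" for x
  define p where "p x = Inf (T x)" for x
  have T_ne: "T x \<noteq> {}" for x
  proof -
    have "(\<lambda>n. complex_of_real (inverse (real (Suc n)))) \<longlonglongrightarrow> of_real 0"
      by (intro tendsto_of_real LIMSEQ_inverse_real_of_nat)
    from filterlim_compose[OF tendsto_smul_left this, of x]
    have "(\<lambda>n. smul (of_real (inverse (real (Suc n)))) x) \<longlonglongrightarrow> 0" by simp
    from filterlim_iff[THEN iffD1, rule_format, OF this W]
    obtain n where "smul (of_real (inverse (real (Suc n)))) x \<in> W"
      by (auto simp: eventually_sequentially)
    then have "real (Suc n) \<in> T x" by (simp add: T_def inverse_eq_divide)
    then show ?thesis by blast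
  qed
  have le: "p x \<le> t" if "t \<in> T x" for x t
    unfolding p_def using that by (intro cInf_lower bdd_belowI[where m = 0]) (auto simp: T_def)
  have ge: "c \<le> p x" if "\<And>t. t \<in> T x \<Longrightarrow> c \<le> t" for c x
    unfolding p_def using that T_ne by (intro cInf_greatest) auto
  have T_add: "s + t \<in> T (x + y)" if s: "s \<in> T x" and t: "t \<in> T y" for s t x y
  proof -
    \<comment> \<open>The rescaled sum is the convex combination of the two rescaled summands with
      weights \<open>s / (s + t)\<close> and \<open>t / (s + t)\<close>.\<close>
    have "smul (of_real (s / (s + t))) (smul (of_real (1 / s)) x) +
        smul (of_real (t / (s + t))) (smul (of_real (1 / t)) y) \<in> W"
      using s t by (intro W_convex) (auto simp: T_def simp flip: add_divide_distrib)
    moreover have "s / (s + t) * (1 / s) = 1 / (s + t)" "t / (s + t) * (1 / t) = 1 / (s + t)"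
      using s t by (auto simp: T_def)
    ultimately have "smul (of_real (1 / (s + t))) (x + y) \<in> W"
      by (simp only: scale_scale of_real_mult[symmetric] scale_right_distrib)
    then show ?thesis using s t by (simp add: T_def)
  qed
  have sub: "real.sublinear p"
    unfolding real.sublinear_def
  proof (intro conjI allI impI)
    have "p 0 \<le> e" if "e > 0" for e
      using that \<open>0 \<in> W\<close> by (intro le) (simp add: T_def)
    then have "p 0 \<le> 0" by (rule field_le_epsilon[of _ 0, simplified])
    moreover have "0 \<le> p 0" by (rule ge) (simp add: T_def)
    ultimately show "p 0 = 0" by simp
  next
    fix x y
    have "p (x + y) - s \<le> p y" if "s \<in> T x" for s
    proof (rule ge)
      fix t assume "t \<in> T y"
      from le[OF T_add[OF that this]] show "p (x + y) - s \<le> t" by simp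
    qed
    then have "p (x + y) - p y \<le> p x"
      by (intro ge) (simp add: algebra_simps)
    then show "p (x + y) \<le> p x + p y" by simp
  next
    fix t :: real and x assume t: "t > 0"
    have "p (smul (of_real t) x) / t \<le> p x"
    proof (rule ge)
      fix s assume "s \<in> T x"
      then have "t * s \<in> T (smul (of_real t) x)"
        using t by (simp add: T_def)
      from le[OF this] t show "p (smul (of_real t) x) / t \<le> s" by (simp add: field_simps)
    qed
    then show "p (smul (of_real t) x) \<le> t * p x" using t by (simp add: field_simps)
  qed
  moreover have "p (- x) = p x" for x
  proof -
    have "T (- x) = T x" using W_minus by (force simp: T_def)
    then show ?thesis by (simp add: p_def)
  qed
  moreover have "\<forall>\<^sub>F x in nhds 0. p x < e" if "e > 0" for e
  proof -
    \<comment> \<open>The factor \<open>2 / e\<close> gives \<open>p x \<le> e / 2\<close>, hence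
      the strict bound.\<close>
    have "filterlim (smul (of_real (2 / e))) (nhds 0) (nhds 0)"
      using tendsto_smul[of "of_real (2 / e)" 0] by simp
    from filterlim_iff[THEN iffD1, rule_format, OF this W]
    show ?thesis
    proof (rule eventually_mono)
      fix x assume "smul (of_real (2 / e)) x \<in> W"
      then have "e / 2 \<in> T x" using \<open>e > 0\<close> by (simp add: T_def)
      from le[OF this] show "p x < e" using \<open>e > 0\<close> by simp
    qed
  qed
  moreover have "x \<in> U" if "p x < 1" for x
  proof -
    from that have "\<exists>t\<in>T x. t < 1" using ge[of x 1] by force
    then obtain t where t: "t > 0" "t < 1" "smul (of_real (1 / t)) x \<in> W"
      by (auto simp: T_def)
    have "smul (of_real t) (smul (of_real (1 / t)) x) + smul (of_real (1 - t)) 0 \<in> W"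
      using t \<open>0 \<in> W\<close> by (intro W_convex) auto
    then have "x \<in> W" using t(1) by simp
    then show ?thesis using \<open>V \<subseteq> U\<close> by (auto simp: W_def)
  qed
  ultimately show thesis using that by blast
qed

text \<open>Mackey's theorem. A real functional \<open>f\<close> is the real part of the complex functional \<open>\<lambda>x. f x - \<i> f (\<i> x)\<close>.\<close>

theorem weakly_bounded_imp_bounded:
  assumes p: "real.sublinear p" and sym: "\<And>x. p (- x) = p x"
    and cont: "\<And>e. e > 0 \<Longrightarrow> \<forall>\<^sub>F x in nhds 0. p x < e"
    and weak: "\<And>f. f \<in> topological_dual smul \<Longrightarrow> \<exists>K. \<forall>x\<in>B. norm (f x) \<le> K"
  obtains K where "\<And>x. x \<in> B \<Longrightarrow> p x \<le> K"
proof -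
  have bounded: "\<exists>K. \<forall>x\<in>B. \<bar>f x\<bar> \<le> K"
    if lin: "Vector_Spaces.linear (\<lambda>t. smul (of_real t)) (*) f" and le: "\<And>x. \<bar>f x\<bar> \<le> p x" for f
  proof -
    have f_add: "f (x + y) = f x + f y" and f_scale: "f (smul (of_real t) x) = t * f x" for x y t
      using lin unfolding Vector_Spaces.linear_iff by auto
    \<comment> \<open>Domination by \<open>p\<close> makes \<open>f\<close> continuous at 0, so it
      yields a member of the dual to which weak boundedness applies.\<close>
    have "(f \<longlongrightarrow> 0) (nhds 0)"
    proof (rule tendstoI)
      fix e :: real assume "e > 0"
      from cont[OF this] show "\<forall>\<^sub>F x in nhds 0. dist (f x) 0 < e"
        by (rule eventually_mono) (simp add: dist_real_def le_less_trans[OF le])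
    qed
    with f_add have f_cont: "continuous_on UNIV f" by (rule additive_continuous_on_UNIV)
    define F where "F x = of_real (f x) - \<i> * of_real (f (smul \<i> x))" for x
    have f_smul: "f (smul c x) = Re c * f x + Im c * f (smul \<i> x)" for c x
    proof -
      have "smul c x = smul (of_real (Re c)) x + smul (of_real (Im c)) (smul \<i> x)"
        by (simp flip: scale_left_distrib) (metis complex_eq mult.commute)
      then show ?thesis by (simp only: f_add f_scale)
    qed
    have f_ii: "f (smul \<i> (smul c x)) = Re c * f (smul \<i> x) - Im c * f x" for c x
      using f_smul[of "\<i> * c" x] by simp
    have "F \<in> topological_dual smul"
      unfolding topological_dual_def Vector_Spaces.linear_iff mem_Collect_eq
    proof (intro conjI allI)
      show "vector_space smul" by (rule vector_space_axioms)
      show "vector_space ((*) :: complex \<Rightarrow> complex \<Rightarrow> complex)"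
        by (simp add: vector_space_def algebra_simps)
      show "F (x + y) = F x + F y" for x y
        by (simp add: F_def f_add scale_right_distrib algebra_simps)
      show "F (smul c x) = c * F x" for c x
        unfolding F_def f_ii unfolding f_smul[of c] by (simp add: complex_eq_iff algebra_simps)
      have "continuous_on UNIV (\<lambda>x. f (smul \<i> x))"
        by (rule continuous_on_compose2[OF f_cont continuous_on_smul]) simp
      with f_cont show "continuous_on UNIV F"
        unfolding F_def by (intro continuous_intros)
    qed
    from weak[OF this] obtain K where K: "\<And>x. x \<in> B \<Longrightarrow> norm (F x) \<le> K" by blast
    have "\<bar>f x\<bar> \<le> K" if "x \<in> B" for x
      using abs_Re_le_cmod[of "F x"] K[OF that] by (simp add: F_def)
    then show ?thesis by blast
  qed
  from real.uniform_boundedness_sublinear[where B = B, OF p sym bounded]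
  show thesis using that by blast
qed

section \<open>Summation by parts for Dirichlet partial sums\<close>

lemma dirichlet_partial_sum_Suc:
  "dirichlet_partial_sum smul a (Suc n) s =
    dirichlet_partial_sum smul a n s + smul (1 / of_nat (Suc n) powr s) (a (Suc n))"
  by (simp add: dirichlet_partial_sum_def)

text \<open>
  With \<open>c n = n\<^sup>-\<^sup>d\<close>, \<open>T\<close> the partial sums at \<open>s\<close> and \<open>A\<close> those at \<open>s - d\<close>, summation by parts is
  the recursion \<open>R (n + 1) - R n = (c n - c (n + 1)) A n\<close> for \<open>R n = T n - c n A n\<close>.
\<close>

lemma dirichlet_partial_sum_shift_bound:
  assumes p: "real.sublinear p" and sym: "\<And>x. p (- x) = p x" and "d \<ge> 0"
    and bound: "\<And>n. p (dirichlet_partial_sum smul a n (s - of_real d)) \<le> K"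
    and "1 \<le> M" "M \<le> N"
  shows "p (dirichlet_partial_sum smul a N s - dirichlet_partial_sum smul a M s)
    \<le> 2 * K * real M powr (- d)"
proof -
  define c where "c n = real n powr (- d)" for n
  define T where "T n = dirichlet_partial_sum smul a n s" for n
  define A where "A n = dirichlet_partial_sum smul a n (s - of_real d)" for n
  define R where "R n = T n - smul (of_real (c n)) (A n)" for n
  have c_nonneg: "c n \<ge> 0" for n by (simp add: c_def)
  \<comment> \<open>Index 0 must be excluded: \<open>0 powr (- d)\<close> is 0, so
    \<open>c 0 < c 1\<close>. Hence the condition \<open>1 \<le> M\<close>.\<close>
  have c_mono: "c (Suc n) \<le> c n" if "n \<ge> 1" for n
    unfolding c_def using that \<open>d \<ge> 0\<close> by (intro powr_mono2') auto
  have A_le: "p (A n) \<le> K" for n using bound by (simp add: A_def)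
  \<comment> \<open>The term at \<open>s\<close> is \<open>c (Suc n)\<close> times the term at
    \<open>s - d\<close>, which is the increment of \<open>A\<close>.\<close>
  have T_Suc: "T (Suc n) = T n + smul (of_real (c (Suc n))) (A (Suc n) - A n)" for n
  proof -
    let ?m = "of_nat (Suc n) :: complex"
    have "complex_of_real (c (Suc n)) = ?m powr of_real (- d)"
      unfolding c_def by (subst powr_of_real[symmetric]) auto
    then have "of_real (c (Suc n)) * (1 / ?m powr (s - of_real d)) = 1 / ?m powr s"
      by (simp add: powr_diff powr_minus field_simps)
    then have "smul (1 / ?m powr s) (a (Suc n)) =
        smul (of_real (c (Suc n))) (smul (1 / ?m powr (s - of_real d)) (a (Suc n)))"
      by (simp only: scale_scale)
    then show ?thesis unfolding T_def A_def dirichlet_partial_sum_Suc by simp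
  qed
  have R_Suc: "R (Suc n) - R n = smul (of_real (c n - c (Suc n))) (A n)" for n
    by (simp add: R_def T_Suc algebra_simps)
  from \<open>M \<le> N\<close> have R_diff: "p (R N - R M) \<le> (c M - c N) * K"
  proof (induction N rule: dec_induct)
    case base
    then show ?case using real.sublinear_zero[OF p] by simp
  next
    case (step n)
    have "p (R (Suc n) - R M) = p (smul (of_real (c n - c (Suc n))) (A n) + (R n - R M))"
      unfolding R_Suc[symmetric] by simp
    also have "\<dots> \<le> p (smul (of_real (c n - c (Suc n))) (A n)) + p (R n - R M)"
      by (rule real.sublinear_add[OF p])
    also have "p (smul (of_real (c n - c (Suc n))) (A n)) = (c n - c (Suc n)) * p (A n)"
      using c_mono[of n] step \<open>1 \<le> M\<close> by (intro real.sublinear_scale[OF p]) simp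
    also have "\<dots> \<le> (c n - c (Suc n)) * K"
      using c_mono[of n] step \<open>1 \<le> M\<close> A_le by (intro mult_left_mono) auto
    finally show ?case using step.IH by (simp add: algebra_simps)
  qed
  have cA: "p (smul (of_real (c n)) (A n)) \<le> c n * K" for n
    unfolding real.sublinear_scale[OF p c_nonneg] using c_nonneg A_le by (intro mult_left_mono) auto
  have "T N - T M = (R N - R M) + (smul (of_real (c N)) (A N) + - smul (of_real (c M)) (A M))"
    by (simp add: R_def)
  also have "p \<dots> \<le> p (R N - R M) + (p (smul (of_real (c N)) (A N)) + p (- smul (of_real (c M)) (A M)))"
    by (intro order_trans[OF real.sublinear_add[OF p]] add_left_mono real.sublinear_add[OF p])
  \<comment> \<open>The contributions of \<open>c N\<close> cancel, and \<open>2 * c M * K\<close>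
    remains.\<close>
  also have "\<dots> \<le> (c M - c N) * K + (c N * K + c M * K)"
    unfolding sym by (intro add_mono R_diff cA)
  finally show ?thesis by (simp add: T_def c_def algebra_simps)
qed

end

section \<open>Uniform convergence and bounds for scalar Dirichlet series\<close>

lemma eventually_uniformity_diff:
  fixes E :: "'a :: {ab_group_add, uniform_topological_group_add} \<times> 'a \<Rightarrow> bool"
  assumes "eventually E uniformity"
  obtains U where "\<forall>\<^sub>F x in nhds 0. x \<in> U" "\<And>x y. y - x \<in> U \<Longrightarrow> E (x, y)"
proof -
  from assms obtain P where P: "eventually P (nhds 0)" "\<And>x y. P (y - x) \<Longrightarrow> E (x, y)"
    unfolding uniformity_eq_nhds_0 eventually_filtercomap by auto
  show thesis by (rule that[of "{x. P x}"]) (use P in auto)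
qed

lemma unif_convergent_on_subset:
  "unif_convergent_on S F \<Longrightarrow> T \<subseteq> S \<Longrightarrow> unif_convergent_on T F"
  unfolding unif_convergent_on_def
  by (elim ex_forward all_forward imp_forward) (auto elim!: eventually_mono)

text \<open>Pointwise limits exist by sequential completeness. To reach \<open>l s\<close> from
  \<open>F n s\<close>, one passes through some \<open>F m s\<close> already close to the limit;
  \<open>m\<close> may depend on \<open>s\<close>, while the threshold \<open>n0\<close> does
  not.\<close>

lemma unif_convergent_on_Cauchy:
  fixes F :: "nat \<Rightarrow> 's \<Rightarrow> 'a :: uniform_space"
  assumes complete: "\<And>x :: nat \<Rightarrow> 'a. Cauchy x \<Longrightarrow> convergent x"
    and Cauchy: "\<And>E. eventually E uniformity \<Longrightarrow> \<exists>n0. \<forall>m\<ge>n0. \<forall>n\<ge>n0. \<forall>s\<in>S. E (F m s, F n s)"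
  shows "unif_convergent_on S F"
proof -
  have "convergent (\<lambda>n. F n s)" if "s \<in> S" for s
    using Cauchy that by (intro complete) (fastforce simp: Cauchy_uniform_iff)
  then obtain l where l: "\<And>s. s \<in> S \<Longrightarrow> (\<lambda>n. F n s) \<longlonglongrightarrow> l s"
    unfolding convergent_def by metis
  show ?thesis
    unfolding unif_convergent_on_def
  proof (intro exI allI impI)
    fix E :: "'a \<times> 'a \<Rightarrow> bool" assume "eventually E uniformity"
    then obtain D where D: "eventually D uniformity" "\<And>x y z. D (x, y) \<Longrightarrow> D (y, z) \<Longrightarrow> E (x, z)"
      by (rule uniformity_transE) blast
    from Cauchy[OF D(1)] obtain n0 where n0: "\<And>m n s. m \<ge> n0 \<Longrightarrow> n \<ge> n0 \<Longrightarrow> s \<in> S \<Longrightarrow> D (F m s, F n s)"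
      by blast
    have "E (F n s, l s)" if "n \<ge> n0" "s \<in> S" for n s
    proof -
      have "\<forall>\<^sub>F y in nhds (l s). D (y, l s)"
        using uniformity_sym[OF D(1)] unfolding eventually_nhds_uniformity
        by (rule eventually_mono) auto
      from filterlim_iff[THEN iffD1, rule_format, OF l[OF \<open>s \<in> S\<close>] this]
      obtain m where "m \<ge> n0" "D (F m s, l s)"
        unfolding eventually_sequentially by (meson le_cases)
      with n0[OF that(1) this(1) that(2)] D(2) show ?thesis by blast
    qed
    then show "\<forall>\<^sub>F n in sequentially. \<forall>s\<in>S. E (F n s, l s)"
      unfolding eventually_sequentially by blast
  qed
qed

text \<open>Rests on \<open>norm (1 / k powr s) = k powr (- Re s)\<close>; it bounds the finitely
  many initial partial sums on a whole half-plane at once.\<close>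

lemma norm_dirichlet_partial_sum_le:
  fixes b :: "nat \<Rightarrow> complex"
  assumes "r \<le> Re s" "n \<le> m"
  shows "norm (dirichlet_partial_sum (*) b n s) \<le> (\<Sum>k = 1..m. real k powr (- r) * norm (b k))"
proof -
  have "norm (dirichlet_partial_sum (*) b n s) \<le> (\<Sum>k = 1..n. norm (1 / of_nat k powr s * b k))"
    unfolding dirichlet_partial_sum_def by (rule norm_sum)
  also have "\<dots> \<le> (\<Sum>k = 1..n. real k powr (- r) * norm (b k))"
  proof (rule sum_mono)
    fix k assume "k \<in> {1..n}"
    then have "norm (1 / of_nat k powr s) = real k powr (- Re s)"
      by (simp add: norm_divide norm_powr_real_powr powr_minus_divide)
    also have "\<dots> \<le> real k powr (- r)"
      using assms(1) \<open>k \<in> {1..n}\<close> by (intro powr_mono) auto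
    finally show "norm (1 / of_nat k powr s * b k) \<le> real k powr (- r) * norm (b k)"
      unfolding norm_mult by (rule mult_right_mono) simp
  qed
  also have "\<dots> \<le> (\<Sum>k = 1..m. real k powr (- r) * norm (b k))"
    using assms(2) by (intro sum_mono2) auto
  finally show ?thesis .
qed

text \<open>From some index \<open>m\<close> on, all partial sums lie within 2 of the
  \<open>m\<close>-th, uniformly in \<open>s\<close>; up to \<open>m\<close> the absolute values of
  the terms suffice.\<close>

lemma dirichlet_partial_sum_bounded:
  fixes b :: "nat \<Rightarrow> complex"
  assumes "unif_convergent_on {s. Re s > r} (dirichlet_partial_sum (*) b)"
  obtains K where "\<And>n s. Re s > r \<Longrightarrow> norm (dirichlet_partial_sum (*) b n s) \<le> K"
proof -
  let ?S = "dirichlet_partial_sum (*) b"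
  from assms obtain l where "uniform_limit {s. Re s > r} ?S l sequentially"
    unfolding unif_convergent_on_metric uniformly_convergent_on_def by blast
  from uniform_limitD[OF this, of 1] obtain m where
    m: "\<And>n s. n \<ge> m \<Longrightarrow> Re s > r \<Longrightarrow> dist (?S n s) (l s) < 1"
    unfolding eventually_sequentially by auto
  define C where "C = (\<Sum>k = 1..m. real k powr (- r) * norm (b k))"
  have C: "norm (?S n s) \<le> C" if "Re s > r" "n \<le> m" for n s
    unfolding C_def using that by (intro norm_dirichlet_partial_sum_le) auto
  have "norm (?S n s) \<le> C + 2" if "Re s > r" for n s
  proof (cases "n \<le> m")
    case True
    then show ?thesis using C[OF that True] by simp
  next
    case False
    have "dist (?S n s) (?S m s) \<le> 2"
      using dist_triangle2[of "?S n s" "?S m s" "l s"] m[of n s] m[of m s] that False by simp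
    moreover have "norm (?S n s) \<le> norm (?S m s) + dist (?S n s) (?S m s)"
      unfolding dist_norm using norm_triangle_sub by blast
    ultimately show ?thesis using C[OF that, of m] by simp
  qed
  with that show thesis by blast
qed

section \<open>Transfer between the series and its images under functionals\<close>

context complex_lcs
begin

lemma dual_dirichlet_partial_sum:
  assumes "f \<in> topological_dual smul"
  shows "f (dirichlet_partial_sum smul a n s) = dirichlet_partial_sum (*) (\<lambda>n. f (a n)) n s"
proof -
  interpret f: Vector_Spaces.linear smul "(*)" f
    using assms by (simp add: topological_dual_def)
  show ?thesis by (simp add: dirichlet_partial_sum_def f.sum f.scale)
qed

text \<open>A linear map continuous at 0 is uniformly continuous, so entourages pull back along
  \<open>f\<close> to entourages.\<close>

lemma dual_unif_convergent_on:
  assumes f: "f \<in> topological_dual smul" and conv: "unif_convergent_on S (dirichlet_partial_sum smul a)"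
  shows "unif_convergent_on S (dirichlet_partial_sum (*) (\<lambda>n. f (a n)))"
proof -
  interpret f: Vector_Spaces.linear smul "(*)" f
    using f by (simp add: topological_dual_def)
  have lim: "(f \<longlongrightarrow> 0) (nhds 0)"
    using f f.zero by (metis (mono_tags, lifting) continuous_on_UNIV_iff_nhds mem_Collect_eq topological_dual_def)
  from conv obtain l where l: "\<And>E. eventually E uniformity \<Longrightarrow>
      \<forall>\<^sub>F n in sequentially. \<forall>s\<in>S. E (dirichlet_partial_sum smul a n s, l s)"
    unfolding unif_convergent_on_def by blast
  show ?thesis
    unfolding unif_convergent_on_def
  proof (intro exI allI impI)
    fix E :: "complex \<times> complex \<Rightarrow> bool" assume "eventually E uniformity"
    then obtain U where U: "\<forall>\<^sub>F x in nhds 0. x \<in> U" "\<And>x y. y - x \<in> U \<Longrightarrow> E (x, y)"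
      by (rule eventually_uniformity_diff) blast
    from filterlim_iff[THEN iffD1, rule_format, OF lim U(1)]
    have "eventually (\<lambda>(x, y). f (y - x) \<in> U) uniformity"
      unfolding uniformity_eq_nhds_0 eventually_filtercomap
      by (intro exI[of _ "\<lambda>x. f x \<in> U"]) auto
    from l[OF this]
    show "\<forall>\<^sub>F n in sequentially. \<forall>s\<in>S. E (dirichlet_partial_sum (*) (\<lambda>n. f (a n)) n s, f (l s))"
      by (rule eventually_mono) (auto simp: f.diff dual_dirichlet_partial_sum[OF f] intro!: U(2))
  qed
qed

lemma unif_convergent_on_shift:
  assumes complete: "\<And>x :: nat \<Rightarrow> 'a. Cauchy x \<Longrightarrow> convergent x"
    and dual: "\<And>f. f \<in> topological_dual smul \<Longrightarrow>
      unif_convergent_on {s. Re s > r} (dirichlet_partial_sum (*) (\<lambda>n. f (a n)))"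
    and "r < r'"
  shows "unif_convergent_on {s. Re s > r'} (dirichlet_partial_sum smul a)"
proof (rule unif_convergent_on_Cauchy[OF complete])
  let ?S = "dirichlet_partial_sum smul a"
  \<comment> \<open>Subtracting \<open>d\<close> moves \<open>Re s > r'\<close> into
    \<open>Re s > r\<close>, where the partial sums are bounded.\<close>
  define d where "d = r' - r"
  have "d > 0" using \<open>r < r'\<close> by (simp add: d_def)
  fix E :: "'a \<times> 'a \<Rightarrow> bool" assume "eventually E uniformity"
  then obtain U where U: "\<forall>\<^sub>F x in nhds 0. x \<in> U" "\<And>x y. y - x \<in> U \<Longrightarrow> E (x, y)"
    by (rule eventually_uniformity_diff) blast
  from gauge_exists[OF U(1)] obtain p where p: "real.sublinear p" "\<And>x. p (- x) = p x"
    "\<And>e. e > 0 \<Longrightarrow> \<forall>\<^sub>F x in nhds 0. p x < e" "\<And>x. p x < 1 \<Longrightarrow> x \<in> U"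
    by blast
  \<comment> \<open>The set ranges over all \<open>n\<close> and all \<open>s\<close> together, so
    the bound obtained for \<open>p\<close> is uniform in both.\<close>
  have "\<exists>K. \<forall>x\<in>{?S n s | n s. Re s > r}. norm (f x) \<le> K" if f: "f \<in> topological_dual smul" for f
  proof -
    from dirichlet_partial_sum_bounded[OF dual[OF f]] obtain K where
      "\<And>n s. Re s > r \<Longrightarrow> norm (dirichlet_partial_sum (*) (\<lambda>n. f (a n)) n s) \<le> K"
      by blast
    then show ?thesis by (intro exI[of _ K]) (auto simp: dual_dirichlet_partial_sum[OF f])
  qed
  from weakly_bounded_imp_bounded[OF p(1-3) this] obtain K where
    K: "\<And>x. x \<in> {?S n s | n s. Re s > r} \<Longrightarrow> p x \<le> K"
    by blast
  have "((\<lambda>n. 2 * K * real n powr (- d)) \<longlongrightarrow> 2 * K * 0) sequentially"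
    using \<open>d > 0\<close>
    by (intro tendsto_mult tendsto_const tendsto_neg_powr filterlim_real_sequentially) auto
  then have "\<forall>\<^sub>F n in sequentially. 2 * K * real n powr (- d) < 1"
    by (rule order_tendstoD) simp
  then obtain n0 where n0: "\<And>n. n \<ge> n0 \<Longrightarrow> 2 * K * real n powr (- d) < 1"
    unfolding eventually_sequentially by blast
  have less: "p (?S n s - ?S m s) < 1" if "Re s > r'" "max 1 n0 \<le> m" "m \<le> n" for m n s
  proof -
    have "p (?S k (s - of_real d)) \<le> K" for k
      using that(1) by (intro K) (force simp: d_def)
    from dirichlet_partial_sum_shift_bound[OF p(1,2) _ this, of m n] \<open>d > 0\<close> that
    have "p (?S n s - ?S m s) \<le> 2 * K * real m powr (- d)" by simp
    also have "\<dots> < 1" using that by (intro n0) simp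
    finally show ?thesis .
  qed
  have "p (?S n s - ?S m s) < 1" if "Re s > r'" "max 1 n0 \<le> m" "max 1 n0 \<le> n" for m n s
  proof (cases "m \<le> n")
    case True
    with that show ?thesis by (intro less)
  next
    case False
    with that have "p (- (?S n s - ?S m s)) < 1" unfolding minus_diff_eq by (intro less) auto
    then show ?thesis by (simp only: p(2))
  qed
  then show "\<exists>n0. \<forall>m\<ge>n0. \<forall>n\<ge>n0. \<forall>s\<in>{s. Re s > r'}. E (?S m s, ?S n s)"
    using U(2) p(4) by blast
qed

end

section \<open>Comparison of the abscissas\<close>

theorem corollary2p8:
  fixes smul :: "complex \<Rightarrow> 'a \<Rightarrow> 'a :: {ab_group_add, uniform_topological_group_add, t2_space}"
    and a :: "nat \<Rightarrow> 'a"
  assumes "complex_lcs smul"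
    and "\<And>x :: nat \<Rightarrow> 'a. Cauchy x \<Longrightarrow> convergent x"
  shows "sigma_u smul a = (SUP x' \<in> topological_dual smul. sigma_u (*) (\<lambda>n. x' (a n)))"
proof (rule antisym)
  interpret complex_lcs smul by (rule assms(1))
  show "(SUP x' \<in> topological_dual smul. sigma_u (*) (\<lambda>n. x' (a n))) \<le> sigma_u smul a"
    unfolding sigma_u_def
    by (intro SUP_least INF_superset_mono) (auto intro: dual_unif_convergent_on)
  show "sigma_u smul a \<le> (SUP x' \<in> topological_dual smul. sigma_u (*) (\<lambda>n. x' (a n)))"
    (is "_ \<le> ?R")
  proof (rule dense_ge)
    fix y assume "?R < y"
    \<comment> \<open>Two reals are needed: every \<open>x'(D)\<close> converges uniformly beyond
      \<open>r\<close>, and the gap up to \<open>r'\<close> pays for the summation by parts.\<close>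
    from ereal_dense2[OF this] obtain r' where r': "?R < ereal r'" "ereal r' < y" by blast
    from ereal_dense2[OF r'(1)] obtain r where r: "?R < ereal r" "r < r'" by auto
    have "unif_convergent_on {s. Re s > r} (dirichlet_partial_sum (*) (\<lambda>n. x' (a n)))"
      if "x' \<in> topological_dual smul" for x'
    proof -
      have "sigma_u (*) (\<lambda>n. x' (a n)) < ereal r"
        by (rule SUP_lessD[OF r(1) that])
      \<comment> \<open>Each \<open>x'\<close> has its own \<open>t\<close>, but all these
        half-planes contain \<open>Re s > r\<close>.\<close>
      then obtain t where "t < r"
          "unif_convergent_on {s. Re s > t} (dirichlet_partial_sum (*) (\<lambda>n. x' (a n)))"
        unfolding sigma_u_def INF_less_iff by auto
      then show ?thesis by (auto elim!: unif_convergent_on_subset)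
    qed
    from unif_convergent_on_shift[OF assms(2) this r(2)]
    have "sigma_u smul a \<le> ereal r'" unfolding sigma_u_def by (intro INF_lower) simp
    with r'(2) show "sigma_u smul a \<le> y" by simp
  qed
qed

end
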